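(* Let $R=\mathbb C[x_1,\dots,x_n]$, let $A\in R^{\ell\times k}$ be a polynomial matrix with complex coefficients and let $S$ be a syzygy matrix of $A$. Then $$\ker_{\mathbb C}A(\xi)=\operatorname{im}_{\mathbb C}S(\xi)\quad\text{for all }\xi\in\mathbb C^n\text{ such that }\operatorname{rank}_{\mathbb C}A(\xi)=\operatorname{rank}_R A.$$ If $\xi\in\mathbb C^n$ satisfies $\operatorname{rank}_{\mathbb C}A(\xi)<\operatorname{rank}_R A$, then $\ker_{\mathbb C}A(\xi)\supsetneq\operatorname{im}_{\mathbb C}S(\xi)$.
   Context: A syzygy matrix of $A\in R^{\ell\times k}$ is a matrix $S\in R^{k\times k'}$ whose columns generate the $R$-module $\ker_R A=\{u\in R^k:Au=0\}$, so that $\ker_R A=\operatorname{im}_R S$. $A(\xi)$ and $S(\xi)$ denote the complex matrices obtained by evaluating the entries at $\xi$. $\operatorname{rank}_R A$ is the largest size of a nonzero minor of $A$, equivalently the maximal value of $\operatorname{rank}_{\mathbb C}A(\xi)$ over $\xi\in\mathbb C^n$. *)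

theory Defs
  imports
    "HOL-Library.Poly_Mapping"
    "Jordan_Normal_Form.Matrix_Kernel"
    "Jordan_Normal_Form.DL_Rank"
    "Jordan_Normal_Form.DL_Submatrix"
begin

text \<open>Polynomials over the complex numbers in variables indexed by all of \<open>nat\<close>: finitely
  supported maps from monomials (finitely supported exponent vectors) to coefficients. The ring
  \<open>\<complex>[x\<^sub>1,\<dots>,x\<^sub>n]\<close> is the subring \<open>poly_ring n\<close> of polynomials in the variables with indices
  \<open>0,\<dots>,n-1\<close>; a carrier set instead of a type of indices also covers \<open>n = 0\<close>.\<close>

type_synonym cpoly = "(nat \<Rightarrow>\<^sub>0 nat) \<Rightarrow>\<^sub>0 complex"

definition poly_ring :: "nat \<Rightarrow> cpoly set" where
  "poly_ring n = {p. \<forall>m \<in> Poly_Mapping.keys p. Poly_Mapping.keys m \<subseteq> {..<n}}"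

definition eval_poly_at :: "complex vec \<Rightarrow> cpoly \<Rightarrow> complex" where
  "eval_poly_at \<xi> p = (\<Sum>m \<in> Poly_Mapping.keys p. Poly_Mapping.lookup p m *
     (\<Prod>i \<in> Poly_Mapping.keys m. (\<xi> $ i) ^ Poly_Mapping.lookup m i))"

definition eval_mat_at :: "complex vec \<Rightarrow> cpoly mat \<Rightarrow> complex mat" where
  "eval_mat_at \<xi> A = map_mat (eval_poly_at \<xi>) A"

definition ker_over :: "nat \<Rightarrow> cpoly mat \<Rightarrow> cpoly vec set" where
  "ker_over n A = {u \<in> mat_kernel A. set\<^sub>v u \<subseteq> poly_ring n}"

text \<open>The elements \<open>S *\<^sub>v w\<close> are exactly the \<open>poly_ring n\<close>-linear combinations of the columns
  of \<open>S\<close>, so this is the module generated by them.\<close>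

definition im_over :: "nat \<Rightarrow> cpoly mat \<Rightarrow> cpoly vec set" where
  "im_over n S = {S *\<^sub>v w |w. w \<in> carrier_vec (dim_col S) \<and> set\<^sub>v w \<subseteq> poly_ring n}"

definition mat_image :: "'a :: comm_ring_1 mat \<Rightarrow> 'a vec set" where
  "mat_image A = {A *\<^sub>v w |w. w \<in> carrier_vec (dim_col A)}"

definition syzygy_matrix :: "nat \<Rightarrow> cpoly mat \<Rightarrow> cpoly mat \<Rightarrow> bool" where
  "syzygy_matrix n A S \<longleftrightarrow>
     dim_row S = dim_col A \<and> elements_mat S \<subseteq> poly_ring n \<and> ker_over n A = im_over n S"

text \<open>The largest size of a nonzero minor. The empty minor has value 1, so the set below is
  nonempty and a matrix without nonzero entries has rank 0.\<close>

definition minor_rank :: "'a :: comm_ring_1 mat \<Rightarrow> nat" where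
  "minor_rank A = Max {card I |I J. I \<subseteq> {..<dim_row A} \<and> J \<subseteq> {..<dim_col A} \<and>
     card I = card J \<and> det (submatrix A I J) \<noteq> 0}"

end

theory Submission
  imports Defs "Jordan_Normal_Form.DL_Rank_Submatrix"
begin

text \<open>Write \<open>r\<close> for the generic rank \<open>minor_rank A\<close>, \<open>k\<close> for the number of columns of \<open>A\<close> and \<open>s\<close>
  for the rank of \<open>A(\<xi>)\<close>, which over the complex numbers is also the largest size of a nonzero minor
  (\<open>rank_eq_minor_rank\<close>). Evaluating \<open>A * S = 0\<close> shows that the image of \<open>S(\<xi>)\<close> always lies in the
  kernel of \<open>A(\<xi>)\<close>.

  Both parts rest on Cramer's rule. Fix a nonzero minor \<open>d\<close> of maximal size, with pivot columns
  \<open>g\<close>. Every further column \<open>j\<close> yields a kernel vector whose entries are, up to sign, minors of that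
  size; among the positions that are not pivots, it has the entry \<open>d\<close> at \<open>j\<close> and \<open>0\<close> elsewhere
  (\<open>mult_cramer_mat\<close>, \<open>cramer_mat_free_row\<close>). This works over any commutative ring.

  If \<open>s = r\<close>, some minor of size \<open>r\<close> does not vanish at \<open>\<xi>\<close>, and its Cramer vectors over the
  polynomials are syzygies, hence generated by the columns of \<open>S\<close>. The values at \<open>\<xi>\<close> of those
  for the free columns span the kernel of \<open>A(\<xi>)\<close>, so this kernel lies in the image of \<open>S(\<xi>)\<close>
  (\<open>kernel_subset_image\<close>).

  If \<open>s < r\<close>, equality would force \<open>S(\<xi>)\<close> to have rank \<open>k - s\<close>, which is impossible: the rank at a
  point is at most the generic rank, and \<open>A * S = 0\<close> over an integral domain bounds the generic rank
  of \<open>S\<close> by \<open>k - r\<close> (\<open>minor_sizes_of_annihilating_mats\<close>, \<open>kernel_neq_image\<close>).\<close>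

section \<open>Evaluation of polynomials\<close>

lemma monomial_value_add:
  fixes m m' :: "nat \<Rightarrow>\<^sub>0 nat" and x :: "nat \<Rightarrow> 'a :: comm_monoid_mult"
  shows "(\<Prod>i \<in> Poly_Mapping.keys (m + m'). x i ^ Poly_Mapping.lookup (m + m') i) =
    (\<Prod>i \<in> Poly_Mapping.keys m. x i ^ Poly_Mapping.lookup m i) *
    (\<Prod>i \<in> Poly_Mapping.keys m'. x i ^ Poly_Mapping.lookup m' i)"
proof -
  let ?F = "Poly_Mapping.keys m \<union> Poly_Mapping.keys m'"
  have ext: "(\<Prod>i \<in> Poly_Mapping.keys q. x i ^ Poly_Mapping.lookup q i) =
      (\<Prod>i \<in> ?F. x i ^ Poly_Mapping.lookup q i)"
    if "Poly_Mapping.keys q \<subseteq> ?F" for q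
    using that by (intro prod.mono_neutral_left) (auto simp: in_keys_iff)
  show ?thesis
    by (simp only: ext[OF Poly_Mapping.keys_add] ext[OF Un_upper1] ext[OF Un_upper2])
      (simp add: lookup_add power_add prod.distrib)
qed

lemma sum_single_keys: "p = (\<Sum>m\<in>Poly_Mapping.keys p. Poly_Mapping.single m (Poly_Mapping.lookup p m))"
proof (rule poly_mapping_eqI)
  fix k
  show "Poly_Mapping.lookup p k =
    Poly_Mapping.lookup (\<Sum>m\<in>Poly_Mapping.keys p. Poly_Mapping.single m (Poly_Mapping.lookup p m)) k"
    by (auto simp: lookup_sum lookup_single when_def in_keys_iff)
qed

lemma eval_poly_at_single:
  "eval_poly_at \<xi> (Poly_Mapping.single m c) =
    c * (\<Prod>i \<in> Poly_Mapping.keys m. (\<xi> $ i) ^ Poly_Mapping.lookup m i)"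
  by (simp add: eval_poly_at_def)

lemma eval_poly_at_const: "eval_poly_at \<xi> (Poly_Mapping.single 0 c) = c"
  by (simp add: eval_poly_at_single)

lemma eval_poly_at_add: "eval_poly_at \<xi> (p + q) = eval_poly_at \<xi> p + eval_poly_at \<xi> q"
  unfolding eval_poly_at_def by (rule setsum_keys_plus_distrib) (simp_all add: algebra_simps)

lemma eval_poly_at_sum: "eval_poly_at \<xi> (\<Sum>i\<in>F. p i) = (\<Sum>i\<in>F. eval_poly_at \<xi> (p i))"
proof (induction F rule: infinite_finite_induct)
  case (infinite A)
  then show ?case by (simp add: eval_poly_at_def)
next
  case empty
  then show ?case by (simp add: eval_poly_at_def)
next
  case (insert x F)
  then show ?case by (simp add: eval_poly_at_add)
qed

lemma eval_poly_at_mult: "eval_poly_at \<xi> (p * q) = eval_poly_at \<xi> p * eval_poly_at \<xi> q"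
proof -
  let ?s = "\<lambda>p m. Poly_Mapping.single m (Poly_Mapping.lookup p m)"
  have "p * q = (\<Sum>m\<in>Poly_Mapping.keys p. \<Sum>m'\<in>Poly_Mapping.keys q. ?s p m * ?s q m')"
    using sum_product[of "?s p" "Poly_Mapping.keys p" "?s q" "Poly_Mapping.keys q"]
    by (simp flip: sum_single_keys)
  then have "eval_poly_at \<xi> (p * q) = (\<Sum>m\<in>Poly_Mapping.keys p. \<Sum>m'\<in>Poly_Mapping.keys q.
      eval_poly_at \<xi> (?s p m) * eval_poly_at \<xi> (?s q m'))"
    by (simp add: eval_poly_at_sum mult_single eval_poly_at_single monomial_value_add mult_ac)
  also have "\<dots> = eval_poly_at \<xi> p * eval_poly_at \<xi> q"
    unfolding eval_poly_at_single sum_product by (simp add: eval_poly_at_def sum_product)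
  finally show ?thesis .
qed

text \<open>Variables with an index beyond the length of \<open>\<xi>\<close> also receive a fixed value, so evaluation is
  multiplicative and additive on the whole type of polynomials.\<close>

lemma comm_ring_hom_eval: "comm_ring_hom (eval_poly_at \<xi>)"
proof
  show "eval_poly_at \<xi> 0 = 0" by (simp add: eval_poly_at_def)
  show "eval_poly_at \<xi> 1 = 1" using eval_poly_at_const[of \<xi> 1] by simp
qed (simp_all add: eval_poly_at_add eval_poly_at_mult)

lemma eval_mat_at_carrier:
  assumes "A \<in> carrier_mat nr nc"
  shows "eval_mat_at \<xi> A \<in> carrier_mat nr nc"
  using assms by (simp add: eval_mat_at_def)

lemma eval_mat_at_dim [simp]:
  "dim_row (eval_mat_at \<xi> A) = dim_row A" "dim_col (eval_mat_at \<xi> A) = dim_col A"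
  by (simp_all add: eval_mat_at_def)

lemma eval_mat_at_index [simp]:
  "i < dim_row A \<Longrightarrow> j < dim_col A \<Longrightarrow> eval_mat_at \<xi> A $$ (i, j) = eval_poly_at \<xi> (A $$ (i, j))"
  by (simp add: eval_mat_at_def)

section \<open>Polynomials in the first variables form a subring\<close>

lemma poly_ring_const: "Poly_Mapping.single 0 c \<in> poly_ring n"
  by (simp add: poly_ring_def)

lemma poly_ring_0: "0 \<in> poly_ring n"
  by (simp add: poly_ring_def)

lemma poly_ring_1: "1 \<in> poly_ring n"
  using poly_ring_const[of 1] by simp

lemma poly_ring_uminus: "p \<in> poly_ring n \<Longrightarrow> - p \<in> poly_ring n"
  by (simp add: poly_ring_def)

lemma poly_ring_add: "p \<in> poly_ring n \<Longrightarrow> q \<in> poly_ring n \<Longrightarrow> p + q \<in> poly_ring n"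
  unfolding poly_ring_def using Poly_Mapping.keys_add[of p q] by blast

lemma poly_ring_mult: "p \<in> poly_ring n \<Longrightarrow> q \<in> poly_ring n \<Longrightarrow> p * q \<in> poly_ring n"
proof -
  assume pq: "p \<in> poly_ring n" "q \<in> poly_ring n"
  show "p * q \<in> poly_ring n"
    unfolding poly_ring_def
  proof safe
    fix m i
    assume m: "m \<in> Poly_Mapping.keys (p * q)" and i: "i \<in> Poly_Mapping.keys m"
    obtain a b where ab: "m = a + b" "a \<in> Poly_Mapping.keys p" "b \<in> Poly_Mapping.keys q"
      using keys_mult[of p q] m by blast
    then show "i < n"
      using pq i Poly_Mapping.keys_add[of a b] unfolding poly_ring_def by blast
  qed
qed

lemma poly_ring_sum: "(\<And>i. i \<in> F \<Longrightarrow> p i \<in> poly_ring n) \<Longrightarrow> (\<Sum>i\<in>F. p i) \<in> poly_ring n"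
  by (induction F rule: infinite_finite_induct) (auto intro: poly_ring_0 poly_ring_add)

lemma poly_ring_prod: "(\<And>i. i \<in> F \<Longrightarrow> p i \<in> poly_ring n) \<Longrightarrow> (\<Prod>i\<in>F. p i) \<in> poly_ring n"
  by (induction F rule: infinite_finite_induct) (auto intro: poly_ring_1 poly_ring_mult)

text \<open>A determinant is a polynomial expression in the entries, with signs as coefficients.\<close>

lemma det_in_poly_ring:
  assumes "\<And>i j. i < dim_row M \<Longrightarrow> j < dim_col M \<Longrightarrow> M $$ (i, j) \<in> poly_ring n"
  shows "det M \<in> poly_ring n"
proof -
  have "signof \<pi> \<in> poly_ring n" for \<pi> :: "nat \<Rightarrow> nat"
    by (simp add: sign_def poly_ring_1 poly_ring_uminus)
  moreover have "(\<Prod>i = 0..<dim_row M. M $$ (i, p i)) \<in> poly_ring n"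
    if "p permutes {0..<dim_row M}" "dim_row M = dim_col M" for p
    using assms permutes_in_image[OF that(1)] that(2)
    by (intro poly_ring_prod) (metis atLeastLessThan_iff)
  ultimately show ?thesis
    unfolding det_def by (auto intro!: poly_ring_sum poly_ring_mult poly_ring_0)
qed

section \<open>Minors and the determinantal rank\<close>

text \<open>Rows and columns are chosen by index functions instead of index sets: such minors remain
  meaningful when an arbitrary further row or column is appended, possibly one that is already
  present or out of order.\<close>

definition minor :: "'a :: comm_ring_1 mat \<Rightarrow> nat \<Rightarrow> (nat \<Rightarrow> nat) \<Rightarrow> (nat \<Rightarrow> nat) \<Rightarrow> 'a" where
  "minor A r f g = det (mat r r (\<lambda>(a, b). A $$ (f a, g b)))"

lemma minor_transpose:
  assumes "\<And>a. a < r \<Longrightarrow> f a < dim_row A" and "\<And>b. b < r \<Longrightarrow> g b < dim_col A"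
  shows "minor A\<^sup>T r g f = minor A r f g"
proof -
  have "mat r r (\<lambda>(a, b). A\<^sup>T $$ (g a, f b)) = (mat r r (\<lambda>(a, b). A $$ (f a, g b)))\<^sup>T"
    using assms by (intro eq_matI) auto
  then show ?thesis
    unfolding minor_def by (metis det_transpose mat_carrier)
qed

lemma (in comm_ring_hom) hom_minor:
  assumes "\<And>a. a < r \<Longrightarrow> f a < dim_row A" and "\<And>b. b < r \<Longrightarrow> g b < dim_col A"
  shows "hom (minor A r f g) = minor (map_mat hom A) r f g"
proof -
  have "map_mat hom (mat r r (\<lambda>(a, b). A $$ (f a, g b))) = mat r r (\<lambda>(a, b). map_mat hom A $$ (f a, g b))"
    using assms by (intro eq_matI) auto
  then show ?thesis
    unfolding minor_def by (metis hom_det)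
qed

lemma eval_minor:
  assumes "\<And>a. a < r \<Longrightarrow> f a < dim_row A" and "\<And>b. b < r \<Longrightarrow> g b < dim_col A"
  shows "eval_poly_at \<xi> (minor A r f g) = minor (eval_mat_at \<xi> A) r f g"
  unfolding eval_mat_at_def using assms by (rule comm_ring_hom.hom_minor[OF comm_ring_hom_eval])

lemma minor_eq_0_if_rows_repeat:
  assumes "\<not> inj_on f {..<r}"
  shows "minor A r f g = 0"
proof -
  obtain a b where "a < r" "b < r" "a \<noteq> b" "f a = f b"
    using assms by (auto simp: inj_on_def)
  then show ?thesis
    unfolding minor_def by (intro det_identical_rows[of _ r a b]) (auto intro!: eq_vecI)
qed

text \<open>Listing distinct rows in another order costs only the sign of the sorting permutation. An integer
  factor is enough to transfer the vanishing of minors.\<close>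

lemma minor_sort_rows:
  assumes "inj_on f {..<r}"
  shows "\<exists>\<sigma> :: int. minor A r f g = of_int \<sigma> * minor A r (pick (f ` {..<r})) g"
proof -
  let ?I = "f ` {..<r}"
  \<comment> \<open>\<open>p a\<close> is the position of \<open>f a\<close> when the rows are listed in increasing order\<close>
  define p where "p a = (if a < r then card {i \<in> ?I. i < f a} else a)" for a
  have card: "card ?I = r" using card_image[OF assms] by simp
  have pick: "pick ?I (p a) = f a" if "a < r" for a
    using that by (simp add: p_def pick_card_in_set)
  have "p a < r" if "a < r" for a
    unfolding p_def using that psubset_card_mono[of ?I "{i \<in> ?I. i < f a}"] card by auto
  moreover have "inj_on p {0..<r}"
    by (intro inj_onI) (metis assms inj_onD pick atLeastLessThan_iff lessThan_iff)
  ultimately have "bij_betw p {0..<r} {0..<r}"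
    by (intro bij_betw_imageI endo_inj_surj) auto
  then have perm: "p permutes {0..<r}"
    by (rule bij_imp_permutes) (simp add: p_def)
  let ?M = "mat r r (\<lambda>(a, b). A $$ (pick ?I a, g b))"
  have "mat r r (\<lambda>(a, b). A $$ (f a, g b)) = mat r r (\<lambda>(a, b). ?M $$ (p a, b))"
    using permutes_in_image[OF perm] by (intro eq_matI) (auto simp: pick)
  then have "minor A r f g = signof p * minor A r (pick ?I) g"
    unfolding minor_def using det_permute_rows[OF _ perm, of ?M] by simp
  then show ?thesis by (intro exI[of _ "sign p"]) simp
qed

lemma minor_pick:
  assumes "I \<subseteq> {..<dim_row A}" "J \<subseteq> {..<dim_col A}" "card I = r" "card J = r"
  shows "minor A r (pick I) (pick J) = det (submatrix A I J)"
proof -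
  have "{i. i < dim_row A \<and> i \<in> I} = I" "{i. i < dim_col A \<and> i \<in> J} = J"
    using assms by auto
  then show ?thesis using assms by (simp add: minor_def submatrix_def)
qed

lemma minor_rank_set:
  fixes A :: "'a :: comm_ring_1 mat"
  defines "X \<equiv> {card I |I J. I \<subseteq> {..<dim_row A} \<and> J \<subseteq> {..<dim_col A} \<and>
     card I = card J \<and> det (submatrix A I J) \<noteq> 0}"
  shows "finite X" and "X \<noteq> {}"
proof -
  have "X \<subseteq> {..dim_row A}"
    unfolding X_def using card_mono[of "{..<dim_row A}"] by auto
  then show "finite X" by (rule finite_subset) simp
  have "det (submatrix A {} {}) = 1" by (intro det_dim_zero) (simp add: submatrix_def)
  then have "0 \<in> X" unfolding X_def by (intro CollectI exI[of _ "{}"]) auto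
  then show "X \<noteq> {}" by blast
qed

text \<open>A minor with a repeated row or column vanishes; any other one is, up to sign, the determinant of
  the submatrix with the same rows and columns in increasing order, to which the maximality of
  the rank applies.\<close>

lemma minor_above_minor_rank:
  assumes "minor_rank A < r" and f: "\<And>a. a < r \<Longrightarrow> f a < dim_row A" and g: "\<And>b. b < r \<Longrightarrow> g b < dim_col A"
  shows "minor A r f g = 0"
proof (cases "inj_on f {..<r} \<and> inj_on g {..<r}")
  case False
  then show ?thesis
    using minor_eq_0_if_rows_repeat[of f r A g] minor_eq_0_if_rows_repeat[of g r "A\<^sup>T" f]
      minor_transpose[of r f A g] f g by auto
next
  case True
  let ?I = "f ` {..<r}" and ?J = "g ` {..<r}"
  have sub: "?I \<subseteq> {..<dim_row A}" "?J \<subseteq> {..<dim_col A}" and card: "card ?I = r" "card ?J = r"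
    using f g True by (auto simp: card_image)
  have "det (submatrix A ?I ?J) = 0"
  proof (rule ccontr)
    assume "det (submatrix A ?I ?J) \<noteq> 0"
    then have "card ?I \<le> minor_rank A"
      unfolding minor_rank_def using sub card by (intro Max_ge minor_rank_set) (metis (mono_tags, lifting) mem_Collect_eq)
    then show False using assms(1) card by simp
  qed
  then have 0: "minor A r (pick ?I) (pick ?J) = 0"
    by (simp add: minor_pick[OF sub card])
  have I: "pick ?I a < dim_row A" if "a < r" for a
    using pick_in_set_le[of a ?I] that card sub by auto
  have J: "pick ?J b < dim_col A" if "b < r" for b
    using pick_in_set_le[of b ?J] that card sub by auto
  obtain \<sigma> \<tau> :: int where "minor A r f g = of_int \<sigma> * minor A r (pick ?I) g"
    and "minor A\<^sup>T r g (pick ?I) = of_int \<tau> * minor A\<^sup>T r (pick ?J) (pick ?I)"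
    using minor_sort_rows True by metis
  moreover have "minor A\<^sup>T r g (pick ?I) = minor A r (pick ?I) g"
    using I g by (intro minor_transpose)
  moreover have "minor A\<^sup>T r (pick ?J) (pick ?I) = minor A r (pick ?I) (pick ?J)"
    using I J by (intro minor_transpose)
  ultimately show ?thesis using 0 by simp
qed

lemma minor_rank_attained:
  obtains I J where "I \<subseteq> {..<dim_row A}" and "J \<subseteq> {..<dim_col A}"
    and "card I = minor_rank A" and "card J = minor_rank A" and "det (submatrix A I J) \<noteq> 0"
proof -
  have "minor_rank A \<in> {card I |I J. I \<subseteq> {..<dim_row A} \<and> J \<subseteq> {..<dim_col A} \<and>
     card I = card J \<and> det (submatrix A I J) \<noteq> 0}"
    unfolding minor_rank_def by (rule Max_in) (use minor_rank_set in blast)+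
  then show thesis using that by auto
qed

text \<open>The columns are recorded as distinct because sums over the pivot coordinates are reindexed along
  \<open>g\<close> and the remaining columns are counted.\<close>

lemma minor_rank_witness:
  obtains f g where "\<And>a. a < minor_rank A \<Longrightarrow> f a < dim_row A" and "\<And>b. b < minor_rank A \<Longrightarrow> g b < dim_col A"
    and "inj_on g {..<minor_rank A}" and "minor A (minor_rank A) f g \<noteq> 0"
proof -
  let ?r = "minor_rank A"
  obtain I J where IJ: "I \<subseteq> {..<dim_row A}" "J \<subseteq> {..<dim_col A}" "card I = ?r" "card J = ?r"
    and det: "det (submatrix A I J) \<noteq> 0"
    by (rule minor_rank_attained)
  have inj: "inj_on (pick J) {..<?r}"
    using pick_mono_le[of _ J] IJ(4) by (intro linorder_inj_onI) fastforce+
  show thesis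
    using pick_in_set_le[of _ I] pick_in_set_le[of _ J] IJ det inj minor_pick[OF IJ]
    by (intro that[of "pick I" "pick J"]) auto
qed

lemma minor_rank_le_dim_col: "minor_rank A \<le> dim_col A"
proof -
  obtain g where "\<And>b. b < minor_rank A \<Longrightarrow> g b < dim_col A" "inj_on g {..<minor_rank A}"
    using minor_rank_witness[of A] by metis
  then show ?thesis
    using card_inj_on_le[of g "{..<minor_rank A}" "{..<dim_col A}"] by auto
qed

section \<open>Kernel vectors from Cramer's rule\<close>

text \<open>Column \<open>j\<close> is the vector that Cramer's rule produces from the \<open>r + 1\<close> columns
  \<open>g 0, \<dots>, g (r - 1), j\<close>: the cofactor along a further, last row that belongs to
  the \<open>b\<close>-th of these columns becomes the coordinate with that column's index. Computing these
  cofactors deletes the last row, so they are the same whichever row is appended to the rows \<open>f\<close>.\<close>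

definition cramer_mat :: "'a :: comm_ring_1 mat \<Rightarrow> nat \<Rightarrow> (nat \<Rightarrow> nat) \<Rightarrow> (nat \<Rightarrow> nat) \<Rightarrow> 'a mat" where
  "cramer_mat A r f g = mat (dim_col A) (dim_col A) (\<lambda>(c, j). \<Sum>b<Suc r. if (g(r := j)) b = c
     then cofactor (mat (Suc r) (Suc r) (\<lambda>(a, b). A $$ (f a, (g(r := j)) b))) r b else 0)"

lemma cramer_mat_carrier [simp]:
  "cramer_mat A r f g \<in> carrier_mat (dim_col A) (dim_col A)"
  by (simp add: cramer_mat_def)

lemma cramer_mat_dim [simp]:
  "dim_row (cramer_mat A r f g) = dim_col A" "dim_col (cramer_mat A r f g) = dim_col A"
  by (simp_all add: cramer_mat_def)

text \<open>Multiplying row \<open>i\<close> of \<open>A\<close> with column \<open>j\<close> is the Laplace expansion, along its last row, of the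
  \<open>(r + 1)\<close>-minor in which row \<open>i\<close> and column \<open>j\<close> are appended. Its size exceeds the rank,
  so it vanishes.\<close>

lemma mult_cramer_mat:
  assumes f: "\<And>a. a < r \<Longrightarrow> f a < dim_row A" and g: "\<And>b. b < r \<Longrightarrow> g b < dim_col A"
    and "minor_rank A \<le> r"
  shows "A * cramer_mat A r f g = 0\<^sub>m (dim_row A) (dim_col A)"
proof (rule eq_matI)
  fix i j
  assume "i < dim_row (0\<^sub>m (dim_row A) (dim_col A) :: 'a mat)" "j < dim_col (0\<^sub>m (dim_row A) (dim_col A) :: 'a mat)"
  then have i: "i < dim_row A" and j: "j < dim_col A" by auto
  let ?g = "g(r := j)"
  let ?M = "\<lambda>f. mat (Suc r) (Suc r) (\<lambda>(a, b). A $$ (f a, ?g b))"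
  have g': "?g b < dim_col A" if "b < Suc r" for b using that g j by auto
  \<comment> \<open>replacing the last row by row \<open>i\<close> of \<open>A\<close> does not change the cofactors along it\<close>
  have cof: "cofactor (?M f) r b = cofactor (?M (f(r := i))) r b" for b
    unfolding cofactor_def mat_delete_def
    by (intro arg_cong2[where f = times] arg_cong[where f = det] eq_matI) auto
  have "(A * cramer_mat A r f g) $$ (i, j) =
      (\<Sum>c<dim_col A. A $$ (i, c) * (\<Sum>b<Suc r. if ?g b = c then cofactor (?M f) r b else 0))"
    using i j by (simp add: cramer_mat_def scalar_prod_def atLeast0LessThan)
  also have "\<dots> = (\<Sum>c<dim_col A. \<Sum>b<Suc r. if ?g b = c then A $$ (i, c) * cofactor (?M f) r b else 0)"
    unfolding sum_distrib_left by (intro sum.cong) auto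
  also have "\<dots> = (\<Sum>b<Suc r. \<Sum>c<dim_col A. if ?g b = c then A $$ (i, c) * cofactor (?M f) r b else 0)"
    by (rule sum.swap)
  also have "\<dots> = (\<Sum>b<Suc r. A $$ (i, ?g b) * cofactor (?M f) r b)"
    using g' by (intro sum.cong) auto
  also have "\<dots> = (\<Sum>b<Suc r. ?M (f(r := i)) $$ (r, b) * cofactor (?M (f(r := i))) r b)"
    by (intro sum.cong) (simp_all add: cof[symmetric] del: fun_upd_apply, simp)
  also have "\<dots> = det (?M (f(r := i)))"
    by (intro laplace_expansion_row[symmetric]) auto
  also have "\<dots> = minor A (Suc r) (f(r := i)) ?g"
    by (simp add: minor_def)
  also have "\<dots> = 0"
    using i f g' assms(3) by (intro minor_above_minor_rank) auto
  finally show "(A * cramer_mat A r f g) $$ (i, j) = 0\<^sub>m (dim_row A) (dim_col A) $$ (i, j)"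
    using i j by simp
qed (simp_all add: cramer_mat_def)

text \<open>Outside the pivot columns, only the appended column \<open>j\<close> contributes to column \<open>j\<close>, and its
  cofactor is the pivot minor itself. So in the rows of \<open>cramer_mat\<close> at free positions, the free
  columns form a scalar multiple of the identity and the pivot columns vanish: kernel vectors with prescribed free coordinates can be written
  down without division.\<close>

lemma cramer_mat_free_row:
  assumes "c < dim_col A" "j < dim_col A" "c \<notin> g ` {..<r}"
  shows "cramer_mat A r f g $$ (c, j) = (if c = j then minor A r f g else 0)"
proof -
  let ?M = "mat (Suc r) (Suc r) (\<lambda>(a, b). A $$ (f a, (g(r := j)) b))"
  have "cramer_mat A r f g $$ (c, j) = (\<Sum>b<Suc r. if (g(r := j)) b = c then cofactor ?M r b else 0)"
    using assms by (simp add: cramer_mat_def)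
  also have "\<dots> = (\<Sum>b<Suc r. if b = r then (if j = c then cofactor ?M r r else 0) else 0)"
    using assms(3) by (intro sum.cong) auto
  also have "\<dots> = (if j = c then cofactor ?M r r else 0)"
    by simp
  also have "cofactor ?M r r = minor A r f g"
  proof -
    have "mat_delete ?M r r = mat r r (\<lambda>(a, b). A $$ (f a, g b))"
      by (intro eq_matI) (auto simp: mat_delete_def)
    then show ?thesis by (simp add: cofactor_def minor_def flip: power2_eq_square mult_2)
  qed
  finally show ?thesis by auto
qed

lemma cramer_mat_in_poly_ring:
  assumes "elements_mat A \<subseteq> poly_ring n"
    and f: "\<And>a. a < r \<Longrightarrow> f a < dim_row A" and g: "\<And>b. b < r \<Longrightarrow> g b < dim_col A"
    and "c < dim_col A" "j < dim_col A"
  shows "cramer_mat A r f g $$ (c, j) \<in> poly_ring n"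
proof -
  have A: "A $$ (a, b) \<in> poly_ring n" if "a < dim_row A" "b < dim_col A" for a b
    using assms(1) that by blast
  have "cofactor (mat (Suc r) (Suc r) (\<lambda>(a, b). A $$ (f a, (g(r := j)) b))) r b \<in> poly_ring n"
    if "b < Suc r" for b
  proof -
    have "(- 1 :: cpoly) ^ m \<in> poly_ring n" for m
      by (cases "even m") (auto intro: poly_ring_1 poly_ring_uminus)
    then show ?thesis
      unfolding cofactor_def
      using f g assms(5) by (intro poly_ring_mult det_in_poly_ring) (auto simp: mat_delete_def intro!: A)
  qed
  then show ?thesis
    using assms(4,5) by (auto simp: cramer_mat_def intro!: poly_ring_sum poly_ring_add poly_ring_0 simp del: fun_upd_apply)
qed

text \<open>The free coordinates determine a kernel vector, because the pivot coordinates solve a square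
  system whose determinant is the pivot minor.\<close>

lemma kernel_vec_eq_0:
  fixes M :: "'a :: idom mat"
  assumes f: "\<And>a. a < r \<Longrightarrow> f a < dim_row M" and g: "\<And>b. b < r \<Longrightarrow> g b < dim_col M"
    and inj: "inj_on g {..<r}" and minor: "minor M r f g \<noteq> 0"
    and x: "x \<in> carrier_vec (dim_col M)" "M *\<^sub>v x = 0\<^sub>v (dim_row M)"
    and free: "\<And>c. c < dim_col M \<Longrightarrow> c \<notin> g ` {..<r} \<Longrightarrow> x $ c = 0"
  shows "x = 0\<^sub>v (dim_col M)"
proof -
  let ?N = "mat r r (\<lambda>(a, b). M $$ (f a, g b))" and ?y = "vec r (\<lambda>b. x $ g b)"
  have "?N *\<^sub>v ?y = 0\<^sub>v r"
  proof (rule eq_vecI)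
    fix a assume "a < dim_vec (0\<^sub>v r :: 'a vec)"
    then have a: "a < r" by simp
    have "(?N *\<^sub>v ?y) $ a = (\<Sum>b<r. M $$ (f a, g b) * x $ g b)"
      using a by (simp add: scalar_prod_def atLeast0LessThan)
    also have "\<dots> = (\<Sum>c\<in>g ` {..<r}. M $$ (f a, c) * x $ c)"
      by (simp add: sum.reindex[OF inj])
    also have "\<dots> = (\<Sum>c<dim_col M. M $$ (f a, c) * x $ c)"
      using g free by (intro sum.mono_neutral_left) auto
    also have "\<dots> = (M *\<^sub>v x) $ f a"
      using f[OF a] x(1) by (auto simp: scalar_prod_def atLeast0LessThan)
    finally show "(?N *\<^sub>v ?y) $ a = 0\<^sub>v r $ a"
      using a f[OF a] x(2) by simp
  qed simp
  then have "?y = 0\<^sub>v r"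
    using minor det_0_iff_vec_prod_zero[of ?N r] unfolding minor_def by (metis mat_carrier vec_carrier)
  then have "x $ g b = 0" if "b < r" for b
    using that by (metis index_vec index_zero_vec(1))
  then show ?thesis
    using x(1) free by (intro eq_vecI) force+
qed

section \<open>Ranks of matrices with product zero\<close>

text \<open>Padding both factors with zeros to square matrices leaves the product unchanged and gives the
  second factor a zero row.\<close>

lemma det_mult_thin:
  assumes Q: "Q \<in> carrier_mat m k" and P: "P \<in> carrier_mat k m" and "k < m"
  shows "det (Q * P :: 'a :: comm_ring_1 mat) = 0"
proof -
  let ?Q = "mat m m (\<lambda>(i, c). if c < k then Q $$ (i, c) else 0)"
  let ?P = "mat m m (\<lambda>(c, j). if c < k then P $$ (c, j) else 0)"
  have "Q * P = ?Q * ?P"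
  proof (rule eq_matI)
    fix i j assume "i < dim_row (?Q * ?P)" "j < dim_col (?Q * ?P)"
    then have ij: "i < m" "j < m" by auto
    have "(\<Sum>c = 0..<k. Q $$ (i, c) * P $$ (c, j)) =
      (\<Sum>c = 0..<m. (if c < k then Q $$ (i, c) else 0) * (if c < k then P $$ (c, j) else 0))"
      using assms(3) by (intro sum.mono_neutral_cong_left) auto
    then show "(Q * P) $$ (i, j) = (?Q * ?P) $$ (i, j)"
      using Q P ij by (simp add: scalar_prod_def)
  qed (use Q P in auto)
  moreover have "det ?P = 0"
  proof -
    have "det ?P = (\<Sum>j<m. ?P $$ (k, j) * cofactor ?P k j)"
      using assms(3) by (intro laplace_expansion_row) auto
    also have "\<dots> = 0" using assms(3) by (intro sum.neutral) auto
    finally show ?thesis .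
  qed
  ultimately show ?thesis by (simp add: det_mult[of _ m])
qed

text \<open>The bound \<open>rank T + rank A \<le> k\<close> for \<open>A * T = 0\<close>, obtained without passing to the field of
  fractions. Let \<open>Q\<close> stack the unit rows selecting the rows \<open>h\<close> on top of the rows \<open>f\<close> of \<open>A\<close>, and
  let \<open>P\<close> put the unit columns selecting the columns \<open>g\<close> next to \<open>T\<close>. Then \<open>Q * P\<close> is block
  triangular with the two minors as determinants of its diagonal blocks, hence nonsingular, although
  it factors through dimension \<open>k\<close>.\<close>

lemma minor_sizes_of_annihilating_mats:
  fixes A T :: "'a :: idom mat"
  assumes AT: "dim_col A = k" "T \<in> carrier_mat k m" "A * T = 0\<^sub>m (dim_row A) m"
    and f: "\<And>a. a < r \<Longrightarrow> f a < dim_row A" and g: "\<And>b. b < r \<Longrightarrow> g b < k"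
    and minor_A: "minor A r f g \<noteq> 0"
    and h: "\<And>a. a < m \<Longrightarrow> h a < k" and minor_T: "minor T m h (\<lambda>b. b) \<noteq> 0"
  shows "m + r \<le> k"
proof (rule ccontr)
  assume "\<not> m + r \<le> k"
  define Q where "Q = mat (m + r) k (\<lambda>(i, c). if i < m then (if c = h i then 1 else 0) else A $$ (f (i - m), c))"
  define P where "P = mat k (m + r) (\<lambda>(c, j). if j < m then T $$ (c, j) else (if c = g (j - m) then 1 else 0))"
  have QP: "Q \<in> carrier_mat (m + r) k" "P \<in> carrier_mat k (m + r)"
    by (simp_all add: Q_def P_def)
  let ?T = "mat m m (\<lambda>(a, b). T $$ (h a, b))" and ?A = "mat r r (\<lambda>(a, b). A $$ (f a, g b))"
  let ?E = "mat m r (\<lambda>(a, b). if h a = g b then 1 else 0)"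
  have T0: "(\<Sum>c<k. A $$ (f i, c) * T $$ (c, j)) = 0" if "i < r" "j < m" for i j
  proof -
    have "(A * T) $$ (f i, j) = (\<Sum>c<k. A $$ (f i, c) * T $$ (c, j))"
      using AT(1,2) f that by (auto simp: scalar_prod_def atLeast0LessThan)
    then show ?thesis using AT(3) f that by simp
  qed
  have "Q * P = four_block_mat ?T ?E (0\<^sub>m r m) ?A"
  proof (rule eq_matI)
    fix i j
    assume "i < dim_row (four_block_mat ?T ?E (0\<^sub>m r m) ?A)" "j < dim_col (four_block_mat ?T ?E (0\<^sub>m r m) ?A)"
    then have ij: "i < m + r" "j < m + r" by simp_all
    have prod: "(Q * P) $$ (i, j) = (\<Sum>c<k. Q $$ (i, c) * P $$ (c, j))"
      using ij QP by (simp add: scalar_prod_def atLeast0LessThan)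
    show "(Q * P) $$ (i, j) = four_block_mat ?T ?E (0\<^sub>m r m) ?A $$ (i, j)"
    proof (cases "i < m")
      case True
      then have "(Q * P) $$ (i, j) = (\<Sum>c<k. if c = h i then P $$ (c, j) else 0)"
        unfolding prod using ij by (intro sum.cong) (auto simp: Q_def P_def)
      then show ?thesis using True ij h[OF True] by (auto simp: P_def)
    next
      case i: False
      show ?thesis
      proof (cases "j < m")
        case True
        then have "(Q * P) $$ (i, j) = (\<Sum>c<k. A $$ (f (i - m), c) * T $$ (c, j))"
          unfolding prod using ij i by (intro sum.cong) (auto simp: Q_def P_def)
        then show ?thesis using True ij i T0[of "i - m" j] by simp
      next
        case False
        then have "(Q * P) $$ (i, j) = (\<Sum>c<k. if c = g (j - m) then A $$ (f (i - m), c) else 0)"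
          unfolding prod using ij i by (intro sum.cong) (auto simp: Q_def P_def)
        then show ?thesis using False ij i g[of "j - m"] by auto
      qed
    qed
  qed (use QP in auto)
  then have "det (Q * P) = det ?T * det ?A"
    by (simp add: det_four_block_mat_lower_left_zero[of _ m _ r])
  moreover have "det (Q * P) = 0"
    using \<open>\<not> m + r \<le> k\<close> QP by (intro det_mult_thin) auto
  ultimately show False using minor_A minor_T by (simp add: minor_def)
qed

section \<open>Determinantal rank over a field\<close>

text \<open>The inclusion \<open>B \<subseteq> set (cols A)\<close> makes the two spans equal, so that \<open>B\<close> generates the column
  space itself.\<close>

lemma (in vec_space) rank_le_card_spanning_cols:
  assumes A: "A \<in> carrier_mat n nc" and "B \<subseteq> set (cols A)" and "set (cols A) \<subseteq> span B"
  shows "rank A \<le> card B"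
proof -
  have B: "B \<subseteq> carrier_vec n" "finite B"
    using assms cols_dim[of A] finite_subset[OF assms(2)] by auto
  have "span (set (cols A)) = span B"
    using assms B by (metis span_is_monotone span_is_subset span_is_submodule subset_antisym)
  then have "rank A = vectorspace.dim class_ring (span_vs B)"
    by (simp add: rank_def)
  also have "\<dots> \<le> card B"
    using B by (intro vectorspace.gen_ge_dim) (auto simp: span_li_not_depend(1)[OF _ span_is_submodule] in_own_span intro: subspace_is_vs span_is_subspace)
  finally show ?thesis .
qed

text \<open>A nonzero minor bounds the rank from below by the independence of its columns. Conversely, over a
  field a column of \<open>cramer_mat\<close> can be divided by the pivot minor and then writes any column of \<open>A\<close>
  as a combination of the pivot columns.\<close>

lemma rank_eq_minor_rank:
  fixes A :: "'a :: field mat"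
  assumes A: "A \<in> carrier_mat n nc"
  shows "vec_space.rank n A = minor_rank A"
proof (rule antisym)
  interpret vec_space "TYPE('a)" n .
  let ?r = "minor_rank A"
  obtain f g where f: "\<And>a. a < ?r \<Longrightarrow> f a < dim_row A" and g: "\<And>b. b < ?r \<Longrightarrow> g b < dim_col A"
    and inj: "inj_on g {..<?r}" and d: "minor A ?r f g \<noteq> 0"
    using minor_rank_witness by metis
  let ?J = "g ` {..<?r}" and ?C = "cramer_mat A ?r f g" and ?d = "minor A ?r f g"
  let ?B = "mat n ?r (\<lambda>(i, b). A $$ (i, g b))"
  have cols_B: "set (cols ?B) = col A ` ?J"
  proof -
    have "col ?B b = col A (g b)" if "b < ?r" for b
      using that A g by (intro eq_vecI) auto
    then show ?thesis by (auto simp: cols_def)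
  qed
  have "col A j \<in> span (col A ` ?J)" if j: "j < dim_col A" for j
  proof (cases "j \<in> ?J")
    case True
    then show ?thesis using A g by (intro span_mem) auto
  next
    case False
    let ?w = "vec ?r (\<lambda>b. - ?C $$ (g b, j) / ?d)"
    have "?B *\<^sub>v ?w = col A j"
    proof (rule eq_vecI)
      fix i assume "i < dim_vec (col A j)"
      then have i: "i < n" using A by simp
      have "0 = (A * ?C) $$ (i, j)"
        using mult_cramer_mat[OF f g order_refl] i j A by simp
      also have "\<dots> = (\<Sum>c<dim_col A. A $$ (i, c) * ?C $$ (c, j))"
        using i j A cramer_mat_carrier[of A ?r f g] by (auto simp: scalar_prod_def atLeast0LessThan)
      also have "\<dots> = (\<Sum>c\<in>insert j ?J. A $$ (i, c) * ?C $$ (c, j))"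
        using g j by (intro sum.mono_neutral_right) (auto simp: cramer_mat_free_row)
      also have "\<dots> = A $$ (i, j) * ?d + (\<Sum>b<?r. A $$ (i, g b) * ?C $$ (g b, j))"
        using False j by (simp add: cramer_mat_free_row sum.reindex[OF inj])
      finally have "(\<Sum>b<?r. A $$ (i, g b) * ?C $$ (g b, j)) = - (A $$ (i, j) * ?d)"
        by (simp add: eq_neg_iff_add_eq_0 add.commute)
      then show "(?B *\<^sub>v ?w) $ i = col A j $ i"
        using i j A d by (simp add: scalar_prod_def atLeast0LessThan sum_negf flip: sum_divide_distrib)
    qed (use A in simp)
    then have "col A j \<in> col_space ?B"
      using A by (subst col_space_eq[of _ ?r]) (auto intro!: exI[of _ ?w])
    then show ?thesis by (simp add: col_space_def cols_B)
  qed
  then have "rank A \<le> card (col A ` ?J)"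
    using A g by (intro rank_le_card_spanning_cols[of _ nc]) (auto simp: cols_def)
  also have "\<dots> \<le> ?r"
    using card_image_le[of "{..<?r}" "\<lambda>b. col A (g b)"] by (simp add: image_image)
  finally show "rank A \<le> ?r" .
next
  interpret vec_space "TYPE('a)" n .
  obtain I J where "J \<subseteq> {..<dim_col A}" "card J = minor_rank A" "det (submatrix A I J) \<noteq> 0"
    by (rule minor_rank_attained)
  moreover from this have "{j. j < nc \<and> j \<in> J} = J"
    using A by auto
  ultimately show "minor_rank A \<le> rank A"
    using rank_gt_minor[OF A, of I J] by simp
qed

section \<open>Syzygies and evaluation\<close>

lemma zero_mat_mult_vec:
  assumes "v \<in> carrier_vec nc"
  shows "0\<^sub>m nr nc *\<^sub>v v = (0\<^sub>v nr :: 'a :: semiring_0 vec)"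
  using assms by (intro eq_vecI) (simp_all add: scalar_prod_def)

text \<open>The columns of \<open>S\<close> are the images of the unit vectors, hence lie in the module of syzygies.\<close>

lemma mult_syzygy_matrix:
  assumes S: "syzygy_matrix n A S"
  shows "A * S = 0\<^sub>m (dim_row A) (dim_col S)"
proof (rule eq_matI)
  fix i j
  assume "i < dim_row (0\<^sub>m (dim_row A) (dim_col S) :: cpoly mat)" "j < dim_col (0\<^sub>m (dim_row A) (dim_col S) :: cpoly mat)"
  then have i: "i < dim_row A" and j: "j < dim_col S" by auto
  let ?u = "unit_vec (dim_col S) j :: cpoly vec"
  have "set\<^sub>v ?u \<subseteq> poly_ring n"
    by (auto simp: vec_set_def unit_vec_def poly_ring_0 poly_ring_1)
  then have "S *\<^sub>v ?u \<in> im_over n S"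
    unfolding im_over_def by (intro CollectI exI[of _ ?u]) auto
  then have "S *\<^sub>v ?u \<in> ker_over n A" using S by (simp add: syzygy_matrix_def)
  moreover have "S *\<^sub>v ?u = col S j"
    using j by (intro eq_vecI) auto
  ultimately have "A *\<^sub>v col S j = 0\<^sub>v (dim_row A)"
    by (simp add: ker_over_def mat_kernel_def)
  then have "(A *\<^sub>v col S j) $ i = 0" using i by simp
  then show "(A * S) $$ (i, j) = 0\<^sub>m (dim_row A) (dim_col S) $$ (i, j)"
    using i j by simp
qed auto

lemma image_subset_kernel:
  assumes S: "syzygy_matrix n A S"
  shows "mat_image (eval_mat_at \<xi> S) \<subseteq> mat_kernel (eval_mat_at \<xi> A)"
proof
  interpret h: comm_ring_hom "eval_poly_at \<xi>" by (rule comm_ring_hom_eval)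
  have A: "A \<in> carrier_mat (dim_row A) (dim_col A)" and SC: "S \<in> carrier_mat (dim_col A) (dim_col S)"
    using S by (auto simp: syzygy_matrix_def)
  have AS: "eval_mat_at \<xi> A * eval_mat_at \<xi> S = 0\<^sub>m (dim_row A) (dim_col S)"
    unfolding eval_mat_at_def h.mat_hom_mult[OF A SC, symmetric] mult_syzygy_matrix[OF S]
    by (intro eq_matI) auto
  fix x assume "x \<in> mat_image (eval_mat_at \<xi> S)"
  then obtain w where w: "w \<in> carrier_vec (dim_col S)" and x: "x = eval_mat_at \<xi> S *\<^sub>v w"
    by (auto simp: mat_image_def)
  have "eval_mat_at \<xi> A *\<^sub>v x = (eval_mat_at \<xi> A * eval_mat_at \<xi> S) *\<^sub>v w"
    unfolding x
    by (rule assoc_mult_mat_vec[OF eval_mat_at_carrier[OF A] eval_mat_at_carrier[OF SC] w, symmetric])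
  also have "\<dots> = 0\<^sub>v (dim_row A)"
    unfolding AS by (rule zero_mat_mult_vec[OF w])
  finally show "x \<in> mat_kernel (eval_mat_at \<xi> A)"
    unfolding x
    by (intro mat_kernelI[OF eval_mat_at_carrier[OF A]] mult_mat_vec_carrier[OF eval_mat_at_carrier[OF SC] w])
qed

text \<open>A minor of full size that does not vanish at \<open>\<xi>\<close> is also a pivot minor over the polynomials.
  Given \<open>u\<close> in the kernel at \<open>\<xi>\<close>, the combination \<open>p\<close> of the Cramer vectors whose coefficients are
  the free coordinates of \<open>u\<close>, as constants, is a polynomial syzygy. Its value at \<open>\<xi>\<close> has the free
  coordinates of \<open>d \<cdot> u\<close>, where \<open>d\<close> is the value of the minor, so it equals \<open>d \<cdot> u\<close>.
  Since \<open>p\<close> lies in the image of \<open>S\<close>, its value lies in the image of \<open>S(\<xi>)\<close>.\<close>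

lemma kernel_subset_image:
  assumes A: "elements_mat A \<subseteq> poly_ring n" and S: "syzygy_matrix n A S"
    and rank: "minor_rank (eval_mat_at \<xi> A) = minor_rank A"
  shows "mat_kernel (eval_mat_at \<xi> A) \<subseteq> mat_image (eval_mat_at \<xi> S)"
proof
  interpret h: comm_ring_hom "eval_poly_at \<xi>" by (rule comm_ring_hom_eval)
  let ?E = "eval_mat_at \<xi> A" and ?r = "minor_rank A" and ?k = "dim_col A"
  have A': "A \<in> carrier_mat (dim_row A) ?k" and E: "?E \<in> carrier_mat (dim_row A) ?k"
    and SC: "S \<in> carrier_mat ?k (dim_col S)" and ES: "eval_mat_at \<xi> S \<in> carrier_mat ?k (dim_col S)"
    using S by (auto simp: syzygy_matrix_def)
  obtain f g where f: "\<And>a. a < ?r \<Longrightarrow> f a < dim_row A" and g: "\<And>b. b < ?r \<Longrightarrow> g b < ?k"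
    and inj: "inj_on g {..<?r}" and minor: "minor ?E ?r f g \<noteq> 0"
    using minor_rank_witness[of ?E] unfolding rank eval_mat_at_dim by metis
  define d where "d = minor ?E ?r f g"
  have d: "eval_poly_at \<xi> (minor A ?r f g) = d"
    unfolding d_def using f g by (rule eval_minor)
  let ?J = "g ` {..<?r}" and ?C = "cramer_mat A ?r f g"
  fix u assume "u \<in> mat_kernel ?E"
  then have u: "u \<in> carrier_vec ?k" and Eu: "?E *\<^sub>v u = 0\<^sub>v (dim_row A)"
    using mat_kernelD[OF E] by auto
  \<comment> \<open>the coefficients of the Cramer vectors: the free coordinates of \<open>u\<close>, as constants\<close>
  define t where "t = vec ?k (\<lambda>c. if c \<in> ?J then 0 else Poly_Mapping.single 0 (u $ c) :: cpoly)"
  define p where "p = ?C *\<^sub>v t"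
  have t: "t \<in> carrier_vec ?k" by (simp add: t_def)
  have p: "p \<in> carrier_vec ?k" using mult_mat_vec_carrier[OF cramer_mat_carrier t] by (simp add: p_def)
  have p_entry: "p $ c = (\<Sum>j<?k. ?C $$ (c, j) * t $ j)" if "c < ?k" for c
    using that t by (simp add: p_def scalar_prod_def atLeast0LessThan)
  have AC: "A * ?C = 0\<^sub>m (dim_row A) ?k"
    by (rule mult_cramer_mat) (simp_all add: f g)
  have "A *\<^sub>v p = (A * ?C) *\<^sub>v t"
    unfolding p_def by (rule assoc_mult_mat_vec[OF A' cramer_mat_carrier t, symmetric])
  also have "\<dots> = 0\<^sub>v (dim_row A)"
    unfolding AC by (rule zero_mat_mult_vec[OF t])
  finally have "p \<in> mat_kernel A" by (rule mat_kernelI[OF A' p])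
  moreover have "p $ c \<in> poly_ring n" if "c < ?k" for c
    unfolding p_entry[OF that]
    by (intro poly_ring_sum poly_ring_mult cramer_mat_in_poly_ring[OF A])
      (use f g that in \<open>auto simp: t_def poly_ring_0 poly_ring_const\<close>)
  ultimately have "p \<in> ker_over n A"
    using p by (auto simp: ker_over_def vec_set_def)
  then have "p \<in> im_over n S" using S by (simp add: syzygy_matrix_def)
  then obtain z where z: "z \<in> carrier_vec (dim_col S)" and pz: "p = S *\<^sub>v z"
    by (auto simp: im_over_def)
  define q where "q = map_vec (eval_poly_at \<xi>) p"
  define z' where "z' = map_vec (eval_poly_at \<xi>) z"
  have z': "z' \<in> carrier_vec (dim_col S)" using z by (simp add: z'_def)
  have qz: "q = eval_mat_at \<xi> S *\<^sub>v z'"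
    unfolding q_def z'_def pz eval_mat_at_def by (rule h.mult_mat_vec_hom[OF SC z])
  have q: "q \<in> carrier_vec ?k" using p by (simp add: q_def)
  have Eq: "?E *\<^sub>v q = 0\<^sub>v (dim_row A)"
  proof -
    have "q \<in> mat_image (eval_mat_at \<xi> S)"
      unfolding mat_image_def qz using z' by (intro CollectI exI[of _ z']) simp
    then show ?thesis using image_subset_kernel[OF S] mat_kernelD(2)[OF E] by blast
  qed
  have q_free: "q $ c = d * u $ c" if c: "c < ?k" "c \<notin> ?J" for c
  proof -
    have "p $ c = (\<Sum>j<?k. if c = j then minor A ?r f g * t $ j else 0)"
      unfolding p_entry[OF c(1)] using c by (intro sum.cong) (auto simp: cramer_mat_free_row)
    also have "\<dots> = minor A ?r f g * Poly_Mapping.single 0 (u $ c)"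
      using c by (simp add: t_def)
    finally show ?thesis
      using c p by (simp add: q_def d h.hom_mult eval_poly_at_const)
  qed
  have "q - d \<cdot>\<^sub>v u = 0\<^sub>v (dim_col ?E)"
  proof (rule kernel_vec_eq_0[where r = ?r and f = f and g = g])
    show "?E *\<^sub>v (q - d \<cdot>\<^sub>v u) = 0\<^sub>v (dim_row ?E)"
      using q u by (simp add: mult_minus_distrib_mat_vec[OF E] mult_mat_vec[OF E] Eq Eu) (intro eq_vecI, auto)
    show "(q - d \<cdot>\<^sub>v u) $ c = 0" if "c < dim_col ?E" "c \<notin> ?J" for c
      using that q u by (simp add: q_free)
  qed (use f g inj minor q u in auto)
  then have qdu: "q = d \<cdot>\<^sub>v u"
  proof (intro eq_vecI)
    fix c assume c: "c < dim_vec (d \<cdot>\<^sub>v u)"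
    then have "(q - d \<cdot>\<^sub>v u) $ c = 0" unfolding \<open>q - d \<cdot>\<^sub>v u = _\<close> using u by simp
    then show "q $ c = (d \<cdot>\<^sub>v u) $ c" using c by simp
  qed (use q u in simp)
  have "u = (1 / d) \<cdot>\<^sub>v q"
    using minor by (simp add: qdu smult_smult_assoc d_def)
  also have "\<dots> = eval_mat_at \<xi> S *\<^sub>v ((1 / d) \<cdot>\<^sub>v z')"
    unfolding qz by (rule mult_mat_vec[symmetric, OF ES z'])
  finally show "u \<in> mat_image (eval_mat_at \<xi> S)"
    using z' by (auto simp: mat_image_def intro!: exI[of _ "(1 / d) \<cdot>\<^sub>v z'"])
qed

text \<open>If the two spaces agreed, the Cramer vectors of \<open>A(\<xi>)\<close> at the \<open>m\<close> free positions would be images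
  under \<open>S(\<xi>)\<close> of vectors \<open>w b\<close>. Let \<open>W\<close> be the matrix of constant polynomials with
  these columns. Then \<open>S * W\<close> is annihilated by \<open>A\<close> and has a nonzero \<open>m\<close>-minor, as the value of that minor at
  \<open>\<xi>\<close> is a power of the pivot minor. Hence \<open>m\<close> plus the generic rank of \<open>A\<close> is at most the number of
  columns, while \<open>m\<close> is the number of columns minus the smaller rank at \<open>\<xi>\<close>.\<close>

lemma kernel_neq_image:
  assumes S: "syzygy_matrix n A S" and rank: "minor_rank (eval_mat_at \<xi> A) < minor_rank A"
  shows "mat_kernel (eval_mat_at \<xi> A) \<noteq> mat_image (eval_mat_at \<xi> S)"
proof
  interpret h: comm_ring_hom "eval_poly_at \<xi>" by (rule comm_ring_hom_eval)
  let ?E = "eval_mat_at \<xi> A" and ?k = "dim_col A"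
  let ?s = "minor_rank ?E" and ?m = "?k - minor_rank ?E"
  assume eq: "mat_kernel ?E = mat_image (eval_mat_at \<xi> S)"
  have A: "A \<in> carrier_mat (dim_row A) ?k" and E: "?E \<in> carrier_mat (dim_row A) ?k"
    and SC: "S \<in> carrier_mat ?k (dim_col S)"
    using S by (auto simp: syzygy_matrix_def)
  obtain f g where f: "\<And>a. a < ?s \<Longrightarrow> f a < dim_row ?E" and g: "\<And>b. b < ?s \<Longrightarrow> g b < dim_col ?E"
    and inj: "inj_on g {..<?s}" and d: "minor ?E ?s f g \<noteq> 0"
    using minor_rank_witness by metis
  let ?d = "minor ?E ?s f g" and ?J = "g ` {..<?s}" and ?C = "cramer_mat ?E ?s f g"
  have "?J \<subseteq> {..<?k}" using g by auto
  then have "card ({..<?k} - ?J) = ?m"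
    by (simp add: card_Diff_subset card_image[OF inj])
  \<comment> \<open>an enumeration of the free positions\<close>
  then obtain h where h: "bij_betw h {0..<?m} ({..<?k} - ?J)"
    using ex_bij_betw_nat_finite[of "{..<?k} - ?J"] by auto
  have h_range: "h a < ?k" "h a \<notin> ?J" if "a < ?m" for a
    using bij_betw_apply[OF h, of a] that by auto
  have h_eq: "h a = h b \<longleftrightarrow> a = b" if "a < ?m" "b < ?m" for a b
    using inj_on_eq_iff[OF bij_betw_imp_inj_on[OF h]] that by simp
  have EC: "?E * ?C = 0\<^sub>m (dim_row ?E) (dim_col ?E)"
    by (rule mult_cramer_mat) (use f g in simp_all)
  have "\<exists>w. w \<in> carrier_vec (dim_col S) \<and> col ?C (h b) = eval_mat_at \<xi> S *\<^sub>v w" if b: "b < ?m" for b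
  proof -
    have "?E *\<^sub>v col ?C (h b) = col (?E * ?C) (h b)"
      using h_range[OF b] by (intro eq_vecI) auto
    also have "\<dots> = 0\<^sub>v (dim_row A)"
      unfolding EC using h_range[OF b] by simp
    finally have "col ?C (h b) \<in> mat_kernel ?E"
      by (intro mat_kernelI[OF E]) (simp_all add: carrier_vecI)
    then have "col ?C (h b) \<in> mat_image (eval_mat_at \<xi> S)" by (simp only: eq)
    then show ?thesis unfolding mat_image_def eval_mat_at_dim by blast
  qed
  then obtain w where w: "\<And>b. b < ?m \<Longrightarrow> w b \<in> carrier_vec (dim_col S)"
    and Sw: "\<And>b. b < ?m \<Longrightarrow> col ?C (h b) = eval_mat_at \<xi> S *\<^sub>v w b"
    by metis
  define W :: "cpoly mat" where "W = mat (dim_col S) ?m (\<lambda>(c, b). Poly_Mapping.single 0 (w b $ c))"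
  have W: "W \<in> carrier_mat (dim_col S) ?m" by (simp add: W_def)
  have T: "S * W \<in> carrier_mat ?k ?m" by (rule mult_carrier_mat[OF SC W])
  have "A * (S * W) = (A * S) * W"
    by (rule assoc_mult_mat[OF A SC W, symmetric])
  then have AT: "A * (S * W) = 0\<^sub>m (dim_row A) ?m"
    unfolding mult_syzygy_matrix[OF S] using W by simp
  have entry: "eval_mat_at \<xi> (S * W) $$ (h a, b) = (if a = b then ?d else 0)" if ab: "a < ?m" "b < ?m" for a b
  proof -
    have col: "col (eval_mat_at \<xi> W) b = w b"
      using ab(2) w[OF ab(2)] by (intro eq_vecI) (simp_all add: W_def eval_poly_at_const)
    have "eval_mat_at \<xi> (S * W) = eval_mat_at \<xi> S * eval_mat_at \<xi> W"
      unfolding eval_mat_at_def by (rule h.mat_hom_mult[OF SC W])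
    then have "eval_mat_at \<xi> (S * W) $$ (h a, b) = (eval_mat_at \<xi> S *\<^sub>v w b) $ h a"
      using h_range(1)[OF ab(1)] ab(2) col by (simp add: carrier_matD[OF SC] carrier_matD[OF W])
    also have "\<dots> = ?C $$ (h a, h b)"
      unfolding Sw[OF ab(2), symmetric] using h_range(1) ab by simp
    also have "\<dots> = (if a = b then ?d else 0)"
      using h_range[OF ab(1)] h_range(1)[OF ab(2)] h_eq[OF ab] by (simp add: cramer_mat_free_row)
    finally show ?thesis .
  qed
  have "minor (eval_mat_at \<xi> (S * W)) ?m h (\<lambda>b. b) = det (?d \<cdot>\<^sub>m 1\<^sub>m ?m)"
    unfolding minor_def[of "eval_mat_at \<xi> (S * W)"] by (intro arg_cong[where f = det] eq_matI) (auto simp: entry)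
  then have "minor (eval_mat_at \<xi> (S * W)) ?m h (\<lambda>b. b) \<noteq> 0"
    using d by simp
  moreover have "eval_poly_at \<xi> (minor (S * W) ?m h (\<lambda>b. b)) = minor (eval_mat_at \<xi> (S * W)) ?m h (\<lambda>b. b)"
    by (rule eval_minor) (simp_all add: h_range(1) carrier_matD[OF SC] carrier_matD[OF W])
  ultimately have minor_T: "minor (S * W) ?m h (\<lambda>b. b) \<noteq> 0"
    by (intro notI) simp
  \<comment> \<open>pivots at a generic point, in general different from those at \<open>\<xi>\<close>\<close>
  obtain f' g' where f': "\<And>a. a < minor_rank A \<Longrightarrow> f' a < dim_row A" and g': "\<And>b. b < minor_rank A \<Longrightarrow> g' b < ?k"
    and minor_A: "minor A (minor_rank A) f' g' \<noteq> 0"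
    using minor_rank_witness[of A] by metis
  have "?m + minor_rank A \<le> ?k"
    by (rule minor_sizes_of_annihilating_mats[OF refl T AT], erule f', erule g', rule minor_A,
        erule h_range(1), rule minor_T)
  then show False using rank minor_rank_le_dim_col[of ?E] by simp
qed

theorem theorem1p3:
  fixes n l k :: nat and A S :: "cpoly mat"
  assumes "A \<in> carrier_mat l k"
    and "elements_mat A \<subseteq> poly_ring n"
    and "syzygy_matrix n A S"
  shows "(\<forall>\<xi> \<in> carrier_vec n.
            vec_space.rank l (eval_mat_at \<xi> A) = minor_rank A \<longrightarrow>
              mat_kernel (eval_mat_at \<xi> A) = mat_image (eval_mat_at \<xi> S)) \<and>
         (\<forall>\<xi> \<in> carrier_vec n.
            vec_space.rank l (eval_mat_at \<xi> A) < minor_rank A \<longrightarrow>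
              mat_image (eval_mat_at \<xi> S) \<subset> mat_kernel (eval_mat_at \<xi> A))"
proof -
  have "vec_space.rank l (eval_mat_at \<xi> A) = minor_rank (eval_mat_at \<xi> A)" for \<xi>
    using assms(1) by (intro rank_eq_minor_rank[of _ l k]) (auto simp: eval_mat_at_def)
  then show ?thesis
    using image_subset_kernel[OF assms(3)] kernel_subset_image[OF assms(2,3)] kernel_neq_image[OF assms(3)]
    by (metis psubsetI subset_antisym)
qed

end
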